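(* Let $K\subset\mathbb R^3$ be a convex body which contains a ball $\mathcal B$ in its interior and let $P$ be a point in the interior of $\mathcal B$, different from the centre of $\mathcal B$. Suppose that for every plane $\Pi$ through $P$, the circle $\Pi\cap\partial\mathcal B$ is an equipotential circle of the section $\Pi\cap K$. Then $K$ is a ball.
   Context: A convex body is a compact convex set with nonempty interior. Given a planar convex body $M$ (contained in a plane $\Pi$, with interior and boundary taken relative to $\Pi$), a circle $\Omega\subset \operatorname{int} M$ (of positive radius) is an equipotential circle of $M$ if there is a constant $\lambda$ such that for every line in $\Pi$ tangent to $\Omega$, with contact point $T$ and cutting $M$ in the chord $AB$ (with $A,B\in\partial M$), one has $|AT|\cdot|TB|=\lambda$. The constant may depend on the section. *)

theory Defs
  imports "HOL-Analysis.Analysis"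
begin

definition convex_body :: "'a::euclidean_space set \<Rightarrow> bool" where
  "convex_body K \<longleftrightarrow> compact K \<and> convex K \<and> interior K \<noteq> {}"

definition is_line :: "'a::euclidean_space set \<Rightarrow> bool" where
  "is_line L \<longleftrightarrow> affine L \<and> aff_dim L = 1"

definition is_plane :: "'a::euclidean_space set \<Rightarrow> bool" where
  "is_plane H \<longleftrightarrow> affine H \<and> aff_dim H = 2"

definition planar_convex_body :: "'a::euclidean_space set \<Rightarrow> 'a set \<Rightarrow> bool" where
  "planar_convex_body H M \<longleftrightarrow>
     is_plane H \<and> M \<subseteq> H \<and> compact M \<and> convex M \<and> top_of_set H interior_of M \<noteq> {}"

definition circle_in :: "'a::euclidean_space set \<Rightarrow> 'a set \<Rightarrow> bool" where
  "circle_in H C \<longleftrightarrow> is_plane H \<and> (\<exists>c\<in>H. \<exists>r>0. C = H \<inter> sphere c r)"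

text \<open>A line in the plane of a circle is tangent to it iff it meets it in exactly one point,
  which is then the contact point.\<close>

definition tangent_at :: "'a::euclidean_space set \<Rightarrow> 'a set \<Rightarrow> 'a set \<Rightarrow> 'a \<Rightarrow> bool" where
  "tangent_at H C L T \<longleftrightarrow> is_line L \<and> L \<subseteq> H \<and> L \<inter> C = {T}"

text \<open>The plane \<open>H\<close> is an explicit argument because interior and boundary of \<open>M\<close> are relative
  to \<open>H\<close>.\<close>

definition equipotential_circle ::
  "'a::euclidean_space set \<Rightarrow> 'a set \<Rightarrow> 'a set \<Rightarrow> bool" where
  "equipotential_circle H M C \<longleftrightarrow>
     planar_convex_body H M \<and> circle_in H C \<and> C \<subseteq> top_of_set H interior_of M \<and>
     (\<exists>k::real. \<forall>L T A B.
        tangent_at H C L T \<and> L \<inter> M = closed_segment A B \<and>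
        A \<in> top_of_set H frontier_of M \<and> B \<in> top_of_set H frontier_of M
        \<longrightarrow> dist A T * dist T B = k)"

end

theory Submission
  imports Defs
begin

text \<open>In one section, let \<open>b(t)\<close> be the length of the tangent chord beyond the contact point at angle
  \<open>t\<close>, and \<open>s\<close> the radius of the circle. Following the tangents around the boundary gives the circle
  map \<open>F(t) = t + 2 arctan (b(t)/s)\<close> with \<open>b(F(t)) = k / b(t)\<close>. Hence the displacement of \<open>F \<circ> F\<close> is
  constant along its orbits, and monotonicity forces it to be globally constant. So either \<open>k = s\<^sup>2\<close>
  and \<open>F \<circ> F\<close> is the half turn, or \<open>b\<close> takes at most two values and is constant. Both times the
  section is symmetric about the centre of its circle, the projection of \<open>c\<close> to the plane.

  Composing such a symmetry with the one in \<open>c\<close> shows that for \<open>x\<close> in the boundary of \<open>K\<close> the whole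
  circle through \<open>x\<close> with axis through \<open>c\<close> parallel to \<open>x - P\<close> lies in the boundary. A boundary point at given
  distance from \<open>c\<close> that is lowest in direction \<open>P - c\<close> must therefore lie on the line \<open>cP\<close>; as
  that line meets the boundary in two points symmetric about \<open>c\<close>, only one distance occurs.\<close>

section \<open>Radial function of a convex body\<close>

text \<open>Lengths are counted in multiples of \<open>v\<close>, which need not be a unit vector;
  so the position of \<open>m + v\<close> relative to a body around \<open>m\<close> is decided by
  comparing the reach with 1.\<close>

definition reach :: "'a::euclidean_space set \<Rightarrow> 'a \<Rightarrow> 'a \<Rightarrow> real" where
  "reach K p v = Sup {t. 0 \<le> t \<and> p + t *\<^sub>R v \<in> K}"

text \<open>Everything strictly between an interior point and a point of a convex set is interior,
  so the ray leaves \<open>K\<close> once. A frontier point on the ray therefore sits exactly at the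
  reach.\<close>

lemma reach:
  assumes "compact K" "convex K" and p: "p \<in> interior K" and "v \<noteq> 0"
  shows reach_pos: "0 < reach K p v"
    and mem_iff_le_reach: "\<And>t. 0 \<le> t \<Longrightarrow> p + t *\<^sub>R v \<in> K \<longleftrightarrow> t \<le> reach K p v"
    and mem_interior_iff_less_reach:
      "\<And>t. 0 \<le> t \<Longrightarrow> p + t *\<^sub>R v \<in> interior K \<longleftrightarrow> t < reach K p v"
proof -
  obtain d where d: "0 < d" "p + d *\<^sub>R v \<in> frontier K"
    "\<And>t. 0 \<le> t \<Longrightarrow> t < d \<Longrightarrow> p + t *\<^sub>R v \<in> interior K"
    using ray_to_frontier[OF compact_imp_bounded[OF assms(1)] p \<open>v \<noteq> 0\<close>] by metis
  have cl: "closed K" by (simp add: assms(1) compact_imp_closed)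
  have dK: "p + d *\<^sub>R v \<in> K" and dI: "p + d *\<^sub>R v \<notin> interior K"
    using d(2) cl by (auto simp: frontier_def)
  have out: "p + t *\<^sub>R v \<notin> K" if "d < t" for t
  proof
    assume "p + t *\<^sub>R v \<in> K"
    then have "open_segment p (p + t *\<^sub>R v) \<subseteq> interior K"
      using in_interior_closure_convex_segment[OF \<open>convex K\<close> p] closure_subset by blast
    moreover have "p + d *\<^sub>R v \<in> open_segment p (p + t *\<^sub>R v)"
      using d(1) that \<open>v \<noteq> 0\<close> unfolding in_segment
      by (intro conjI exI[of _ "d / t"]) (auto simp: algebra_simps)
    ultimately show False using dI by blast
  qed
  have mem: "p + t *\<^sub>R v \<in> K \<longleftrightarrow> t \<le> d" if "0 \<le> t" for t
  proof
    show "p + t *\<^sub>R v \<in> K \<Longrightarrow> t \<le> d" using out by force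
    assume "t \<le> d"
    then consider "t < d" | "t = d" by linarith
    then show "p + t *\<^sub>R v \<in> K" using d(3) dK that interior_subset by cases auto
  qed
  have "{t. 0 \<le> t \<and> p + t *\<^sub>R v \<in> K} = {0..d}" using mem by auto
  then have eq: "reach K p v = d" using d(1) by (simp add: reach_def)
  show "0 < reach K p v" using eq d by simp
  show "p + t *\<^sub>R v \<in> K \<longleftrightarrow> t \<le> reach K p v" if "0 \<le> t" for t using mem[OF that] eq by simp
  show "p + t *\<^sub>R v \<in> interior K \<longleftrightarrow> t < reach K p v" if "0 \<le> t" for t
    using mem[OF that] eq d(3)[OF that] dI interior_subset[of K] by (cases "t = d") auto
qed

text \<open>For nonnegative \<open>t\<close>, \<open>t < reach\<close> is membership in the open set
  \<open>interior K\<close> and \<open>reach < t\<close> membership in the open complement of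
  \<open>K\<close>; both persist under small changes of base point and direction.\<close>

lemma continuous_on_reach:
  fixes p v :: "real \<Rightarrow> 'a::euclidean_space"
  assumes K: "compact K" "convex K" and p: "\<And>x. p x \<in> interior K" and v: "\<And>x. v x \<noteq> 0"
    and cp: "continuous_on UNIV p" and cv: "continuous_on UNIV v"
  shows "continuous_on UNIV (\<lambda>x. reach K (p x) (v x))"
proof -
  have R: "0 < reach K (p x) (v x)"
    "0 \<le> t \<Longrightarrow> p x + t *\<^sub>R v x \<in> K \<longleftrightarrow> t \<le> reach K (p x) (v x)"
    "0 \<le> t \<Longrightarrow> p x + t *\<^sub>R v x \<in> interior K \<longleftrightarrow> t < reach K (p x) (v x)" for x t
    using reach[OF K p[of x] v[of x]] by auto
  have tend: "((\<lambda>x. p x + t *\<^sub>R v x) \<longlongrightarrow> p a + t *\<^sub>R v a) (at a)" for a t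
    using cp cv by (intro tendsto_intros) (auto simp: continuous_on_def)
  have "((\<lambda>x. reach K (p x) (v x)) \<longlongrightarrow> reach K (p a) (v a)) (at a)" for a
  proof (rule order_tendstoI)
    fix t assume "t < reach K (p a) (v a)"
    show "eventually (\<lambda>x. t < reach K (p x) (v x)) (at a)"
    proof (cases "0 \<le> t")
      case True
      then have "p a + t *\<^sub>R v a \<in> interior K" using R(3) \<open>t < _\<close> by blast
      from topological_tendstoD[OF tend open_interior this]
      show ?thesis by (rule eventually_mono) (use R(3) True in blast)
    next
      case False
      then show ?thesis using R(1) by (intro always_eventually allI) (meson less_le_trans not_le less_imp_le le_less_trans)
    qed
  next
    fix t assume t: "reach K (p a) (v a) < t"
    then have t0: "0 \<le> t" using R(1)[of a] by linarith
    then have "p a + t *\<^sub>R v a \<in> - K" using R(2) t by force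
    from topological_tendstoD[OF tend _ this] K(1)
    have "eventually (\<lambda>x. p x + t *\<^sub>R v x \<in> - K) (at a)"
      by (simp add: compact_imp_closed open_Compl)
    then show "eventually (\<lambda>x. reach K (p x) (v x) < t) (at a)"
      by (rule eventually_mono) (use R(2)[OF t0] in force)
  qed
  then show ?thesis by (simp add: continuous_on_def)
qed

section \<open>Dynamics of the tangent map\<close>

lemma two_valued_continuous_constant:
  fixes b :: "real \<Rightarrow> real"
  assumes b: "continuous_on UNIV b" and two: "\<And>t. b t = x \<or> b t = y"
  shows "b s = b t"
proof -
  have "b constant_on UNIV"
  proof (rule continuous_finite_range_constant[OF _ b])
    have "range b \<subseteq> {x, y}" using two by blast
    then show "finite (b ` UNIV)" by (rule finite_subset) simp
  qed simp
  then show ?thesis by (auto simp: constant_on_def)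
qed

text \<open>If \<open>F s\<close> were at least \<open>F t\<close> for some \<open>s < t\<close>,
  then, since \<open>F\<close> exceeds the identity and so climbs above \<open>F s\<close> further
  right, it would take the value \<open>F s\<close> again at or after \<open>t\<close>.\<close>

lemma inj_advance_imp_strict_mono:
  fixes F :: "real \<Rightarrow> real"
  assumes F: "continuous_on UNIV F" "inj F" and adv: "\<And>t. t < F t"
  shows "strict_mono F"
proof (rule strict_monoI, rule ccontr)
  fix s t :: real assume "s < t" "\<not> F s < F t"
  define m where "m = max t (F s)"
  have "F t \<le> F s" "F s \<le> F m" "t \<le> m"
    using \<open>\<not> F s < F t\<close> adv[of m] by (auto simp: m_def)
  then obtain x where "t \<le> x" "F x = F s"
    using IVT'[of F t "F s" m] continuous_on_subset[OF F(1)] by auto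
  then show False using injD[OF F(2), of x s] \<open>s < t\<close> by linarith
qed

text \<open>An increasing map whose displacement is constant along orbits is a translation, since two
  orbits with different displacements would cross.\<close>

lemma increasing_displacement_constant:
  fixes \<alpha> :: "real \<Rightarrow> real"
  assumes mono: "strict_mono (\<lambda>t. t + \<alpha> t)"
    and inv: "\<And>t. \<alpha> (t + \<alpha> t) = \<alpha> t"
    and per: "\<And>t. \<alpha> (t + c) = \<alpha> t" and c: "c > 0"
  shows "\<alpha> s = \<alpha> t"
proof -
  \<comment> \<open>As the displacement is constant along orbits,
    \<open>t + real n * \<alpha> t\<close> is the n-th iterate of the map.\<close>
  have orb: "strict_mono (\<lambda>t. t + real n * \<alpha> t) \<and> (\<forall>t. \<alpha> (t + real n * \<alpha> t) = \<alpha> t)" for n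
  proof (induction n)
    case 0
    show ?case by (simp add: strict_mono_def)
  next
    case (Suc n)
    have eq: "t + real (Suc n) * \<alpha> t = (t + real n * \<alpha> t) + \<alpha> (t + real n * \<alpha> t)" for t
      using Suc by (simp add: algebra_simps)
    have "strict_mono (\<lambda>t. t + real (Suc n) * \<alpha> t)"
      unfolding eq using strict_mono_compose[OF mono conjunct1[OF Suc]] Suc by (simp add: o_def)
    moreover have "\<alpha> (t + real (Suc n) * \<alpha> t) = \<alpha> t" for t
      unfolding eq using inv[of "t + real n * \<alpha> t"] Suc by simp
    ultimately show ?case by blast
  qed
  \<comment> \<open>A point starting on the left with the larger displacement would overtake after
    finitely many steps, although iterates preserve order.\<close>
  have le: "\<alpha> x \<le> \<alpha> y" if "x < y" for x y
  proof (rule ccontr)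
    assume "\<not> \<alpha> x \<le> \<alpha> y"
    then obtain n where "y - x < real n * (\<alpha> x - \<alpha> y)"
      using reals_Archimedean3[of "\<alpha> x - \<alpha> y"] by auto
    moreover have "x + real n * \<alpha> x < y + real n * \<alpha> y"
      using orb[of n] that by (simp add: strict_mono_def)
    ultimately show False by (simp add: algebra_simps)
  qed
  have perk: "\<alpha> (x + real k * c) = \<alpha> x" for x k
    using per[of "x + real _ * c"] by (induction k) (simp_all add: algebra_simps)
  \<comment> \<open>Shifting \<open>x\<close> by whole periods beyond \<open>y\<close> leaves its
    displacement unchanged, so the inequality holds for all pairs.\<close>
  have ge: "\<alpha> y \<le> \<alpha> x" for x y
  proof -
    obtain k where "y - x < real k * c" using reals_Archimedean3[OF c] by blast
    then show ?thesis using le[of y "x + real k * c"] perk by simp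
  qed
  show ?thesis using ge by (meson antisym)
qed

text \<open>Here \<open>a\<close> and \<open>b\<close> are the backward and forward tangent lengths
  at angle \<open>t\<close>. The hypothesis \<open>link\<close> expresses that the two tangent
  segments from an outer point are equally long.\<close>

lemma half_turn_periodic:
  fixes a b :: "real \<Rightarrow> real"
  assumes cont: "continuous_on UNIV b" and s: "s > 0"
    and pos: "\<And>t. a t > 0" "\<And>t. b t > 0"
    and prod: "\<And>t. a t * b t = k"
    and per: "\<And>t. b (t + 2 * pi) = b t"
    and link: "\<And>t. a (t + 2 * arctan (b t / s)) = b t"
  shows "b (t + pi) = b t"
proof -
  define F where "F t = t + 2 * arctan (b t / s)" for t
  \<comment> \<open>Half the displacement of \<open>F \<circ> F\<close>: the second step starts with
    tangent length \<open>k / b t\<close>.\<close>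
  define \<gamma> where "\<gamma> t = arctan (b t / s) + arctan (k / b t / s)" for t
  have k: "k > 0" using pos prod[of 0] by (metis mult_pos_pos)
  have bF: "b (F t) = k / b t" for t
    using prod[of "F t"] link[of t] pos(2)[of t] by (simp add: F_def field_simps)
  have FF: "F (F t) = t + 2 * \<gamma> t" for t
    unfolding F_def[of "F t"] bF by (simp add: F_def \<gamma>_def)
  have bFF: "b (t + 2 * \<gamma> t) = b t" for t
    using bF[of "F t"] bF[of t] k pos(2)[of t] by (simp add: FF)
  have contF: "continuous_on UNIV F"
    unfolding F_def using cont s by (intro continuous_intros) auto
  \<comment> \<open>\<open>F t\<close> determines \<open>b t\<close> through \<open>a\<close>, and
    then \<open>t\<close> itself.\<close>
  have "inj F"
  proof (rule injI)
    fix x y assume eq: "F x = F y"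
    then have "b x = b y" using link[of x] link[of y] by (simp add: F_def)
    then show "x = y" using eq by (simp add: F_def)
  qed
  moreover have "t < F t" for t using pos(2)[of t] s by (simp add: F_def)
  ultimately have "strict_mono F" by (rule inj_advance_imp_strict_mono[OF contF])
  then have "strict_mono (\<lambda>t. t + 2 * \<gamma> t)" by (simp add: FF[symmetric] strict_mono_def)
  moreover have per\<gamma>: "\<gamma> (t + 2 * pi) = \<gamma> t" and bFF\<gamma>: "\<gamma> (t + 2 * \<gamma> t) = \<gamma> t" for t
    using per[of t] bFF[of t] by (simp_all only: \<gamma>_def)
  ultimately have const: "\<gamma> x = \<gamma> y" for x y
    using increasing_displacement_constant[of "\<lambda>t. 2 * \<gamma> t" "2 * pi" x y]
    by (simp add: per\<gamma> bFF\<gamma>)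
  \<comment> \<open>As \<open>\<gamma> 0\<close> lies between 0 and \<open>pi\<close>, a zero cosine
    makes \<open>F \<circ> F\<close> the half turn. Otherwise the addition formula for the tangent
    applies.\<close>
  show ?thesis
  proof (cases "cos (\<gamma> 0) = 0")
    case True
    have "0 < arctan (b 0 / s)" "0 < arctan (k / b 0 / s)"
      using pos(2)[of 0] k s by simp_all
    then have "0 < \<gamma> 0" "\<gamma> 0 < pi"
      using arctan_ubound[of "b 0 / s"] arctan_ubound[of "k / b 0 / s"]
      unfolding \<gamma>_def by linarith+
    then have "\<gamma> 0 = pi / 2"
      using cos_inj_pi[of "\<gamma> 0" "pi / 2"] pi_gt_zero unfolding True cos_pi_half by argo
    then have "2 * \<gamma> t = pi" using const[of t 0] by linarith
    then show ?thesis using bFF[of t] by (simp only:)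
  next
    case False
    \<comment> \<open>The two arguments have the constant product \<open>k / s\<^sup>2\<close>, so
      constancy of \<open>\<gamma>\<close> becomes constancy of
      \<open>b x + k / b x\<close>.\<close>
    have tan: "tan (\<gamma> 0) = (b x + k / b x) / s / (1 - k / s\<^sup>2)" for x
    proof -
      have "tan (\<gamma> 0) = tan (arctan (b x / s) + arctan (k / b x / s))"
        using const[of 0 x] by (simp add: \<gamma>_def)
      also have "\<dots> = (b x / s + k / b x / s) / (1 - b x / s * (k / b x / s))"
        using False const[of 0 x] by (subst tan_add) (simp_all add: \<gamma>_def tan_arctan)
      also have "b x / s * (k / b x / s) = k / s\<^sup>2"
        using pos(2)[of x] by (simp add: power2_eq_square)
      finally show ?thesis by (simp add: add_divide_distrib)
    qed
    \<comment> \<open>For \<open>k = s\<^sup>2\<close> the arctangents have reciprocal arguments and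
      add up to \<open>pi / 2\<close>, the excluded case.\<close>
    have ne: "1 - k / s\<^sup>2 \<noteq> 0"
    proof
      assume "1 - k / s\<^sup>2 = 0"
      then have "k / b 0 / s = 1 / (b 0 / s)" using s pos(2)[of 0] by (simp add: field_simps power2_eq_square)
      then have "\<gamma> 0 = pi / 2"
        using pos(2)[of 0] s by (simp add: \<gamma>_def Transcendental.arctan_inverse[of "b 0 / s", simplified])
      then show False using False cos_pi_half by metis
    qed
    \<comment> \<open>With sum and product fixed, \<open>b x\<close> is a root of the quadratic
      whose roots are \<open>b 0\<close> and \<open>k / b 0\<close>.\<close>
    have "b x = b 0 \<or> b x = k / b 0" for x
    proof -
      have "(b x + k / b x) / s / (1 - k / s\<^sup>2) = (b 0 + k / b 0) / s / (1 - k / s\<^sup>2)"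
        using tan[of x] tan[of 0] by (rule trans[OF sym])
      then have "b x + k / b x = b 0 + k / b 0"
        using ne s by (simp only: divide_cancel_right) auto
      then have "(b x - b 0) * (b x - k / b 0) = 0"
        using pos(2)[of x] pos(2)[of 0] by (simp add: field_simps)
      then show ?thesis by simp
    qed
    then show ?thesis by (rule two_valued_continuous_constant[OF cont])
  qed
qed

section \<open>Polar coordinates and symmetry of a section\<close>

definition direction :: "'a::real_vector \<Rightarrow> 'a \<Rightarrow> real \<Rightarrow> 'a" where
  "direction u v t = cos t *\<^sub>R u + sin t *\<^sub>R v"

lemma direction_add:
  "direction u v (s + t) = cos t *\<^sub>R direction u v s + sin t *\<^sub>R direction u v (s + pi / 2)"
  by (simp add: direction_def cos_add sin_add algebra_simps)

lemma direction_add_pi [simp]: "direction u v (t + pi) = - direction u v t"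
  by (simp add: direction_def)

lemma direction_add_2pi [simp]: "direction u v (t + 2 * pi) = direction u v t"
  by (simp add: direction_def)

lemma norm_direction:
  assumes "norm u = 1" "norm v = 1" "u \<bullet> v = 0"
  shows "norm (direction u v t) = 1"
proof -
  have "u \<bullet> u = 1" "v \<bullet> v = 1" using assms by (simp_all add: dot_square_norm)
  then have "direction u v t \<bullet> direction u v t = (cos t)\<^sup>2 + (sin t)\<^sup>2"
    using assms(3) by (simp add: direction_def inner_commute[of v u] inner_add_left inner_add_right
        power2_eq_square)
  then show ?thesis by (simp add: norm_eq_1)
qed

lemma direction_orthogonal:
  assumes "norm u = 1" "norm v = 1" "u \<bullet> v = 0"
  shows "direction u v t \<bullet> direction u v (t + pi / 2) = 0"
proof -
  have "u \<bullet> u = 1" "v \<bullet> v = 1" using assms by (simp_all add: dot_square_norm)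
  then show ?thesis
    using assms(3) by (simp add: direction_def cos_add sin_add inner_commute[of v u] algebra_simps)
qed

lemma polar_direction:
  obtains \<rho> t where "0 \<le> \<rho>" "x *\<^sub>R u + y *\<^sub>R v = \<rho> *\<^sub>R direction u v t"
proof
  let ?z = "Complex x y"
  have "rcis (cmod ?z) (Arg ?z) = ?z" by (rule rcis_cmod_Arg)
  then have "x = cmod ?z * cos (Arg ?z)" "y = cmod ?z * sin (Arg ?z)"
    by (simp_all add: complex_eq_iff)
  then show "x *\<^sub>R u + y *\<^sub>R v = cmod ?z *\<^sub>R direction u v (Arg ?z)"
    by (simp add: direction_def scaleR_add_right)
qed simp

text \<open>Opposite tangent segments are equally long by the half-turn periodicity. Points outside
  the disc about \<open>p\<close> are reached along tangents; the disc itself lies in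
  \<open>K\<close> by convexity.\<close>

lemma constant_power_imp_symmetric:
  fixes K :: "'a::euclidean_space set"
  assumes K: "compact K" "convex K"
    and uv: "norm u = 1" "norm v = 1" "u \<bullet> v = 0" and s: "s > 0"
    and circ: "\<And>t. p + s *\<^sub>R direction u v t \<in> interior K"
    and prod: "\<And>t. reach K (p + s *\<^sub>R direction u v t) (- direction u v (t + pi / 2)) *
                    reach K (p + s *\<^sub>R direction u v t) (direction u v (t + pi / 2)) = k"
    and x: "p + (x *\<^sub>R u + y *\<^sub>R v) \<in> K"
  shows "p - (x *\<^sub>R u + y *\<^sub>R v) \<in> K"
proof -
  define E where "E = direction u v"
  define b where "b t = reach K (p + s *\<^sub>R E t) (E (t + pi / 2))" for t
  define a where "a t = reach K (p + s *\<^sub>R E t) (- E (t + pi / 2))" for t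
  have ne: "E t \<noteq> 0" "- E t \<noteq> 0" for t
    using norm_direction[OF uv, of t] by (auto simp: E_def)
  have circ': "p + s *\<^sub>R E t \<in> interior K" for t using circ by (simp add: E_def)
  note R = reach[OF K circ']
  have contE: "continuous_on UNIV E"
    unfolding E_def direction_def by (intro continuous_intros)
  have contb: "continuous_on UNIV b"
    unfolding b_def
    by (intro continuous_on_reach[OF K] circ' ne continuous_intros
        continuous_on_compose2[OF contE]) auto
  have link: "a (t + 2 * arctan (b t / s)) = b t" for t
  proof -
    define \<theta> where "\<theta> = arctan (b t / s)"
    define \<sigma> where "\<sigma> = t + 2 * \<theta>"
    have pos: "0 < b t" unfolding b_def by (rule R(1)[OF ne(1)])
    have c: "cos \<theta> > 0"
      unfolding \<theta>_def by (intro cos_gt_zero_pi arctan_lbound arctan_ubound)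
    have "tan \<theta> = b t / s" by (simp add: \<theta>_def tan_arctan)
    then have bs: "b t = (s / cos \<theta>) * sin \<theta>" and ss: "s = (s / cos \<theta>) * cos \<theta>"
      using s c by (simp_all add: tan_def field_simps)
    \<comment> \<open>The tangents at angles \<open>t\<close> and \<open>\<sigma>\<close> meet at
      angle \<open>t + \<theta>\<close>, at distance \<open>s / cos \<theta>\<close> from
      \<open>p\<close>. So the end of the forward segment at \<open>t\<close> is also the end of the
      backward one at \<open>\<sigma>\<close>.\<close>
    have "s *\<^sub>R E t + b t *\<^sub>R E (t + pi / 2) = (s / cos \<theta>) *\<^sub>R E (t + \<theta>)"
      unfolding E_def direction_add[of u v t \<theta>] using bs ss
      by (simp add: scaleR_add_right)
    also have "t + \<theta> = \<sigma> + (- \<theta>)" by (simp add: \<sigma>_def)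
    also have "(s / cos \<theta>) *\<^sub>R E (\<sigma> + (- \<theta>)) = s *\<^sub>R E \<sigma> + b t *\<^sub>R (- E (\<sigma> + pi / 2))"
      unfolding E_def direction_add[of u v \<sigma> "- \<theta>"] using bs ss
      by (simp add: scaleR_diff_right)
    finally have eq: "p + s *\<^sub>R E \<sigma> + b t *\<^sub>R (- E (\<sigma> + pi / 2)) =
        p + s *\<^sub>R E t + b t *\<^sub>R E (t + pi / 2)"
      by (simp add: algebra_simps)
    have "p + s *\<^sub>R E t + b t *\<^sub>R E (t + pi / 2) \<in> K - interior K"
      using R(2,3)[OF ne(1), of "b t" t "t + pi / 2"] pos by (simp add: b_def)
    then have "b t \<le> a \<sigma>" "\<not> b t < a \<sigma>"
      using R(2,3)[OF ne(2), of "b t" \<sigma> "\<sigma> + pi / 2"] pos unfolding a_def eq[symmetric] by auto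
    then show ?thesis by (simp add: \<sigma>_def \<theta>_def)
  qed
  have per: "b (t + 2 * pi) = b t" for t
  proof -
    have "t + 2 * pi + pi / 2 = (t + pi / 2) + 2 * pi" by simp
    then show ?thesis unfolding b_def E_def by (simp only: direction_add_2pi)
  qed
  have half: "b (t + pi) = b t" for t
  proof (rule half_turn_periodic[OF contb s _ _ _ per link])
    show "a t > 0" "b t > 0" for t using R(1) ne by (auto simp: a_def b_def)
    show "a t * b t = k" for t using prod by (simp add: a_def b_def E_def)
  qed
  obtain \<rho> t where \<rho>: "0 \<le> \<rho>" "x *\<^sub>R u + y *\<^sub>R v = \<rho> *\<^sub>R E t"
    using polar_direction unfolding E_def by metis
  have "p - \<rho> *\<^sub>R E t \<in> K"
  proof (cases "\<rho> \<le> s")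
    case True
    have mem: "p + s *\<^sub>R E t \<in> K" "p + s *\<^sub>R E (t + pi) \<in> K"
      using circ' interior_subset by blast+
    \<comment> \<open>The weight solves \<open>w * s - (1 - w) * s = - \<rho>\<close>, for two
      antipodal points of the circle.\<close>
    define w where "w = (s - \<rho>) / (2 * s)"
    have "w *\<^sub>R (p + s *\<^sub>R E t) + (1 - w) *\<^sub>R (p + s *\<^sub>R E (t + pi)) \<in> K"
      using True \<rho>(1) s by (intro convexD[OF K(2) mem]) (simp_all add: w_def)
    also have "w *\<^sub>R (p + s *\<^sub>R E t) + (1 - w) *\<^sub>R (p + s *\<^sub>R E (t + pi)) =
        p + (w * s + w * s - s) *\<^sub>R E t"
      unfolding E_def direction_add_pi
      by (simp add: algebra_simps) (simp flip: scaleR_add_left)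
    also have "w * s = (s - \<rho>) / 2" using s by (simp add: w_def)
    finally show ?thesis by (simp add: field_simps)
  next
    case False
    \<comment> \<open>A tangent from a point at distance \<open>\<rho>\<close> and angle
      \<open>t\<close> touches the circle at angle \<open>t - \<theta>\<close> and has length
      \<open>\<rho> * sin \<theta>\<close>.\<close>
    define \<theta> where "\<theta> = arccos (s / \<rho>)"
    define \<tau> where "\<tau> = t - \<theta>"
    have sr: "0 \<le> s / \<rho>" "s / \<rho> \<le> 1" using False s \<rho>(1) by simp_all
    have "cos \<theta> = s / \<rho>" using sr by (simp add: \<theta>_def)
    then have c: "\<rho> * cos \<theta> = s" using False s by simp
    have h: "0 \<le> \<rho> * sin \<theta>"
      using sr \<rho>(1) arccos_lbound[of "s / \<rho>"] arccos_ubound[of "s / \<rho>"]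
      by (intro mult_nonneg_nonneg sin_ge_zero) (simp_all add: \<theta>_def)
    have eq: "\<rho> *\<^sub>R E t = s *\<^sub>R E \<tau> + (\<rho> * sin \<theta>) *\<^sub>R E (\<tau> + pi / 2)"
      using direction_add[of u v \<tau> \<theta>] c by (simp add: E_def \<tau>_def scaleR_add_right)
    have "p + s *\<^sub>R E \<tau> + (\<rho> * sin \<theta>) *\<^sub>R E (\<tau> + pi / 2) \<in> K"
      using x \<rho>(2) eq by (simp add: add.assoc)
    then have "\<rho> * sin \<theta> \<le> b (\<tau> + pi)"
      unfolding half unfolding b_def using R(2)[OF ne(1) h] by blast
    then have "p + s *\<^sub>R E (\<tau> + pi) + (\<rho> * sin \<theta>) *\<^sub>R E (\<tau> + pi + pi / 2) \<in> K"
      unfolding b_def using R(2)[OF ne(1) h] by blast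
    moreover have "\<tau> + pi + pi / 2 = (\<tau> + pi / 2) + pi" by simp
    then have "E (\<tau> + pi) = - E \<tau>" "E (\<tau> + pi + pi / 2) = - E (\<tau> + pi / 2)"
      unfolding E_def by (simp_all only: direction_add_pi)
    ultimately show ?thesis unfolding eq by (simp add: algebra_simps)
  qed
  then show ?thesis by (simp add: \<rho>(2))
qed

section \<open>From equipotential circles to constant power\<close>

text \<open>Links the reach in space with the frontier relative to \<open>H\<close>: the ray stays
  in \<open>H\<close>, so its points just past the reach show that the end point is not relatively
  interior.\<close>

lemma reach_point_in_frontier_of:
  assumes K: "compact K" "convex K" "p \<in> interior K" and "w \<noteq> 0"
    and H: "\<And>t. p + t *\<^sub>R w \<in> H"
  shows "p + reach K p w *\<^sub>R w \<in> top_of_set H frontier_of (H \<inter> K)"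
proof -
  note R = reach[OF K \<open>w \<noteq> 0\<close>]
  let ?d = "reach K p w"
  have "p + ?d *\<^sub>R w \<in> H \<inter> K" using H R(1) R(2)[of ?d] by simp
  then have cl: "p + ?d *\<^sub>R w \<in> top_of_set H closure_of (H \<inter> K)"
    using closure_of_subset[of "H \<inter> K" "top_of_set H"] by auto
  have "p + ?d *\<^sub>R w \<notin> top_of_set H interior_of (H \<inter> K)"
  proof
    assume "p + ?d *\<^sub>R w \<in> top_of_set H interior_of (H \<inter> K)"
    then obtain U where U: "open U" "p + ?d *\<^sub>R w \<in> U" "H \<inter> U \<subseteq> K"
      by (auto simp: interior_of_def openin_open)
    have "((\<lambda>t. p + t *\<^sub>R w) \<longlongrightarrow> p + ?d *\<^sub>R w) (at_right ?d)"
      by (intro tendsto_intros)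
    from topological_tendstoD[OF this U(1,2)]
    have "eventually (\<lambda>t. t > ?d \<and> p + t *\<^sub>R w \<in> U) (at_right ?d)"
      by (intro eventually_conj eventually_at_right_less)
    then obtain t where "t > ?d" "p + t *\<^sub>R w \<in> U"
      using eventually_happens'[OF trivial_limit_at_right_real] by blast
    then show False using U(3) H[of t] R(1) R(2)[of t] by auto
  qed
  then show ?thesis using cl by (simp add: frontier_of_def)
qed

lemma mem_affine_hull_2_iff: "z \<in> affine hull {a, a + w} \<longleftrightarrow> (\<exists>t. z = a + t *\<^sub>R w)"
proof
  assume "z \<in> affine hull {a, a + w}"
  then obtain x y where "z = x *\<^sub>R a + y *\<^sub>R (a + w)" "x + y = 1"
    by (auto simp: affine_hull_2)
  then have "z = a + y *\<^sub>R w"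
    by (metis scaleR_add_left scaleR_add_right scaleR_one add.assoc)
  then show "\<exists>t. z = a + t *\<^sub>R w" ..
next
  assume "\<exists>t. z = a + t *\<^sub>R w"
  then obtain t where "z = (1 - t) *\<^sub>R a + t *\<^sub>R (a + w)" by (auto simp: algebra_simps)
  then show "z \<in> affine hull {a, a + w}"
    unfolding affine_hull_2 by (intro CollectI exI[of _ "1 - t"] exI[of _ t]) simp
qed

text \<open>The metric hypotheses make \<open>p\<close> the centre and \<open>s\<close> the radius
  of the circle cut from the sphere. At each angle the chord of the tangent line ends at the two
  reach points.\<close>

lemma equipotential_circle_constant_power:
  fixes K :: "'a::euclidean_space set"
  assumes K: "compact K" "convex K"
    and uv: "norm u = 1" "norm v = 1" "u \<bullet> v = 0"
    and H: "affine H" "\<And>x y. p + (x *\<^sub>R u + y *\<^sub>R v) \<in> H"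
    and orth: "(p - c) \<bullet> u = 0" "(p - c) \<bullet> v = 0"
    and s: "s > 0" and r: "r > 0" "r\<^sup>2 = s\<^sup>2 + (norm (p - c))\<^sup>2"
    and ball: "cball c r \<subseteq> interior K"
    and eq: "equipotential_circle H (H \<inter> K) (H \<inter> sphere c r)"
  obtains k where "\<And>t. p + s *\<^sub>R direction u v t \<in> interior K"
    "\<And>t. reach K (p + s *\<^sub>R direction u v t) (- direction u v (t + pi / 2)) *
         reach K (p + s *\<^sub>R direction u v t) (direction u v (t + pi / 2)) = k"
proof -
  obtain k where k: "\<forall>L T A B. tangent_at H (H \<inter> sphere c r) L T \<and>
      L \<inter> (H \<inter> K) = closed_segment A B \<and>
      A \<in> top_of_set H frontier_of (H \<inter> K) \<and> B \<in> top_of_set H frontier_of (H \<inter> K)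
      \<longrightarrow> dist A T * dist T B = k"
    using eq unfolding equipotential_circle_def by (elim conjE exE) (rule that)
  have main: "p + s *\<^sub>R direction u v t \<in> interior K \<and>
      reach K (p + s *\<^sub>R direction u v t) (- direction u v (t + pi / 2)) *
         reach K (p + s *\<^sub>R direction u v t) (direction u v (t + pi / 2)) = k" for t
  proof -
    define e where "e = direction u v t"
    define w where "w = direction u v (t + pi / 2)"
    define T where "T = p + s *\<^sub>R e"
    have e: "norm e = 1" "norm w = 1" "e \<bullet> w = 0"
      unfolding e_def w_def using norm_direction[OF uv] direction_orthogonal[OF uv] by auto
    have pe: "(p - c) \<bullet> e = 0" "(p - c) \<bullet> w = 0"
      unfolding e_def w_def direction_def using orth by (simp_all add: inner_add_right)
    have w0: "w \<noteq> 0" "- w \<noteq> 0" using e(2) by auto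
    \<comment> \<open>\<open>p - c\<close>, \<open>e\<close> and \<open>w\<close> are pairwise
      orthogonal, so the tangent line leaves the ball on both sides of \<open>T\<close>.\<close>
    have nrm: "(dist c (T + x *\<^sub>R w))\<^sup>2 = r\<^sup>2 + x\<^sup>2" for x
    proof -
      have "T + x *\<^sub>R w - c = (p - c) + (s *\<^sub>R e + x *\<^sub>R w)" by (simp add: T_def)
      then have "(dist c (T + x *\<^sub>R w))\<^sup>2 = (norm ((p - c) + (s *\<^sub>R e + x *\<^sub>R w)))\<^sup>2"
        by (metis dist_commute dist_norm)
      also have "\<dots> = (norm (p - c))\<^sup>2 + (norm (s *\<^sub>R e + x *\<^sub>R w))\<^sup>2"
        using pe by (intro norm_add_Pythagorean) (simp add: orthogonal_def inner_add_right)
      also have "(norm (s *\<^sub>R e + x *\<^sub>R w))\<^sup>2 = (norm (s *\<^sub>R e))\<^sup>2 + (norm (x *\<^sub>R w))\<^sup>2"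
        using e by (intro norm_add_Pythagorean) (simp add: orthogonal_def)
      finally show ?thesis using e r(2) by simp
    qed
    have sph: "T + x *\<^sub>R w \<in> sphere c r \<longleftrightarrow> x = 0" for x
    proof -
      have "T + x *\<^sub>R w \<in> sphere c r \<longleftrightarrow> (dist c (T + x *\<^sub>R w))\<^sup>2 = r\<^sup>2"
        using r(1) by simp
      then show ?thesis by (simp add: nrm)
    qed
    have TI: "T \<in> interior K" using sph[of 0] ball sphere_cball[of c r] by auto
    have lineH: "T + x *\<^sub>R w \<in> H" for x
    proof -
      have "T + x *\<^sub>R w = p + ((s * cos t - x * sin t) *\<^sub>R u + (s * sin t + x * cos t) *\<^sub>R v)"
        by (simp add: T_def e_def w_def direction_def cos_add sin_add algebra_simps)
      then show ?thesis using H(2) by simp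
    qed
    have lineH': "T + x *\<^sub>R (- w) \<in> H" for x using lineH[of "- x"] by simp
    note R = reach[OF K TI w0(1)] and R' = reach[OF K TI w0(2)]
    define b where "b = reach K T w"
    define a where "a = reach K T (- w)"
    have pos: "a > 0" "b > 0" using R(1) R'(1) by (simp_all add: a_def b_def)
    have memK: "T + x *\<^sub>R w \<in> K \<longleftrightarrow> - a \<le> x \<and> x \<le> b" for x
      using R(2)[of x] R'(2)[of "- x"] pos by (cases "0 \<le> x") (auto simp: a_def b_def)
    have seg: "(1 - l) *\<^sub>R (T + a *\<^sub>R (- w)) + l *\<^sub>R (T + b *\<^sub>R w) =
        T + ((1 - l) * - a + l * b) *\<^sub>R w" for l
      by (simp add: algebra_simps)
    let ?L = "affine hull {T, T + w}"
    have "tangent_at H (H \<inter> sphere c r) ?L T"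
      unfolding tangent_at_def is_line_def
    proof (intro conjI)
      show "aff_dim ?L = 1" using w0 by simp
      show "?L \<subseteq> H" using lineH by (auto simp: mem_affine_hull_2_iff)
      show "?L \<inter> (H \<inter> sphere c r) = {T}"
        using lineH[of 0] sph[of 0] hull_subset[of "{T, T + w}" affine]
        by (auto simp: mem_affine_hull_2_iff sph simp del: mem_sphere)
    qed simp
    moreover have "?L \<inter> (H \<inter> K) = closed_segment (T + a *\<^sub>R (- w)) (T + b *\<^sub>R w)"
    proof (intro set_eqI iffI)
      fix z assume "z \<in> ?L \<inter> (H \<inter> K)"
      then obtain x where x: "z = T + x *\<^sub>R w" "- a \<le> x" "x \<le> b"
        using memK by (auto simp: mem_affine_hull_2_iff)
      define l where "l = (x + a) / (a + b)"
      have "l * (a + b) = x + a" using pos by (simp add: l_def)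
      then have "x = (1 - l) * - a + l * b" by (simp add: algebra_simps)
      then have "z = (1 - l) *\<^sub>R (T + a *\<^sub>R (- w)) + l *\<^sub>R (T + b *\<^sub>R w)"
        unfolding seg x(1) by simp
      moreover have "0 \<le> l" "l \<le> 1" using x pos by (auto simp: l_def)
      ultimately show "z \<in> closed_segment (T + a *\<^sub>R (- w)) (T + b *\<^sub>R w)"
        unfolding in_segment by blast
    next
      fix z assume "z \<in> closed_segment (T + a *\<^sub>R (- w)) (T + b *\<^sub>R w)"
      then obtain l where l: "0 \<le> l" "l \<le> 1"
        "z = (1 - l) *\<^sub>R (T + a *\<^sub>R (- w)) + l *\<^sub>R (T + b *\<^sub>R w)"
        unfolding in_segment by blast
      define x where "x = (1 - l) * - a + l * b"
      have z: "z = T + x *\<^sub>R w" unfolding l(3) x_def seg ..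
      have x: "x = l * (a + b) - a" by (simp add: x_def algebra_simps)
      have "l * (a + b) \<le> a + b" "0 \<le> l * (a + b)"
        using l pos mult_left_le_one_le[of "a + b" l] by simp_all
      then have "- a \<le> x" "x \<le> b" using x by linarith+
      then show "z \<in> ?L \<inter> (H \<inter> K)"
        unfolding z using memK lineH by (auto simp: mem_affine_hull_2_iff)
    qed
    moreover have "T + a *\<^sub>R (- w) \<in> top_of_set H frontier_of (H \<inter> K)"
      unfolding a_def by (rule reach_point_in_frontier_of[OF K TI w0(2) lineH'])
    moreover have "T + b *\<^sub>R w \<in> top_of_set H frontier_of (H \<inter> K)"
      unfolding b_def by (rule reach_point_in_frontier_of[OF K TI w0(1) lineH])
    ultimately have "dist (T + a *\<^sub>R (- w)) T * dist T (T + b *\<^sub>R w) = k"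
      by (intro k[rule_format] conjI)
    then have "a * b = k" using e pos by (simp add: dist_norm)
    then show ?thesis using TI by (simp add: a_def b_def T_def e_def w_def)
  qed
  then show ?thesis using that by blast
qed

section \<open>From symmetric sections to a ball\<close>

text \<open>In \<open>sym\<close>, the orthogonality conditions make \<open>m\<close> the foot of
  the perpendicular from \<open>c\<close> to a plane containing \<open>x\<close> and
  \<open>P\<close>; for \<open>m = c\<close> any plane through the three points will do.\<close>

lemma sectional_symmetry_imp_ball:
  fixes K :: "'a::euclidean_space set"
  assumes K: "compact K" "convex K" and ball: "cball c r \<subseteq> interior K"
    and P: "dist c P < r" "P \<noteq> c"
    and sym: "\<And>x m. x \<in> K \<Longrightarrow> (x - m) \<bullet> (m - c) = 0 \<Longrightarrow> (P - m) \<bullet> (m - c) = 0 \<Longrightarrow>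
                2 *\<^sub>R m - x \<in> K"
  shows "\<exists>\<rho>>0. K = cball c \<rho>"
proof -
  have cI: "c \<in> interior K"
    using ball P(1) by (meson centre_in_cball le_less_trans less_imp_le subsetD zero_le_dist)
  have F: "x \<in> frontier K \<longleftrightarrow> x \<in> K \<and> x \<notin> interior K" for x
    using compact_imp_closed[OF K(1)] by (auto simp: frontier_def)
  have symF: "2 *\<^sub>R m - x \<in> frontier K"
    if x: "x \<in> frontier K" and m: "(x - m) \<bullet> (m - c) = 0" "(P - m) \<bullet> (m - c) = 0" for x m
  proof (rule ccontr)
    assume nF: "2 *\<^sub>R m - x \<notin> frontier K"
    \<comment> \<open>The right angle at \<open>m\<close> keeps \<open>m\<close> no farther from
      \<open>c\<close> than \<open>P\<close>, hence inside the ball.\<close>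
    have "(norm ((P - m) + (m - c)))\<^sup>2 = (norm (P - m))\<^sup>2 + (norm (m - c))\<^sup>2"
      using m(2) by (intro norm_add_Pythagorean) (simp add: orthogonal_def)
    then have "(norm (m - c))\<^sup>2 \<le> (norm (P - c))\<^sup>2" by simp
    then have "norm (m - c) \<le> norm (P - c)" by (rule power2_le_imp_le) simp
    then have mI: "m \<in> interior K"
      using ball P(1) by (auto simp: dist_norm norm_minus_commute)
    then have "x \<noteq> m" using x F by blast
    then have ne: "m - x \<noteq> 0" "x - m \<noteq> 0" by simp_all
    note R = reach[OF K mI ne(1)] and R' = reach[OF K mI ne(2)]
    \<comment> \<open>Were the image of \<open>x\<close> interior, the chord would extend beyond it,
      and reflecting the longer half back would extend \<open>K\<close> beyond
      \<open>x\<close>.\<close>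
    let ?d = "reach K m (m - x)"
    have "2 *\<^sub>R m - x \<in> K" using sym x m F by blast
    then have "m + 1 *\<^sub>R (m - x) \<in> interior K" using nF F by (simp add: scaleR_2 add_diff_eq)
    then have "1 < ?d" using R(3)[of 1] by simp
    have "m + ?d *\<^sub>R (m - x) \<in> K" using R(1) R(2)[of ?d] by simp
    moreover have "(m + ?d *\<^sub>R (m - x) - m) \<bullet> (m - c) = 0"
      using m(1) by (simp add: inner_diff_left)
    ultimately have "2 *\<^sub>R m - (m + ?d *\<^sub>R (m - x)) \<in> K" using sym m(2) by blast
    also have "2 *\<^sub>R m - (m + ?d *\<^sub>R (m - x)) = m + ?d *\<^sub>R (x - m)"
      by (simp add: algebra_simps scaleR_2)
    finally have "?d \<le> reach K m (x - m)" using R(1) R'(2)[of ?d] by simp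
    moreover have "reach K m (x - m) \<le> 1" using x F R'(3)[of 1] by simp
    ultimately show False using \<open>1 < ?d\<close> by simp
  qed
  have neg: "2 *\<^sub>R c - x \<in> frontier K" if "x \<in> frontier K" for x
    using symF[OF that, of c] by simp
  have turn: "w \<in> frontier K"
    if x: "x \<in> frontier K" and w: "norm (w - c) = norm (x - c)" "(w - x) \<bullet> (x - P) = 0" for x w
  proof -
    \<comment> \<open>Reflecting in \<open>m\<close> and then in \<open>c\<close> translates by
      \<open>2 *\<^sub>R (c - m)\<close>; this \<open>m\<close> sends \<open>x\<close> to
      \<open>w\<close>. The two hypotheses on \<open>w\<close> become the two orthogonality
      conditions.\<close>
    define m where "m = c + (1 / 2) *\<^sub>R (x - w)"
    have "(x - c) \<bullet> (x - c) = (w - c) \<bullet> (w - c)" using w(1) by (simp add: dot_square_norm)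
    then have 1: "(x - m) \<bullet> (m - c) = 0"
      by (simp add: m_def inner_diff_left inner_diff_right inner_add_left inner_add_right inner_commute algebra_simps)
    have "(P - m) \<bullet> (m - c) = (x - m) \<bullet> (m - c) + (1 / 2) * ((w - x) \<bullet> (x - P))"
      by (simp add: m_def inner_diff_left inner_diff_right inner_add_left inner_add_right inner_commute algebra_simps)
    then have 2: "(P - m) \<bullet> (m - c) = 0" using 1 w(2) by simp
    have "2 *\<^sub>R c - (2 *\<^sub>R m - x) \<in> frontier K" using neg symF[OF x 1 2] by blast
    also have "2 *\<^sub>R c - (2 *\<^sub>R m - x) = w" by (simp add: m_def scaleR_2 algebra_simps)
    finally show ?thesis .
  qed
  define p where "p = P - c"
  have p: "p \<noteq> 0" using P(2) by (simp add: p_def)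
  note Rp = reach[OF K cI p]
  define \<rho> where "\<rho> = reach K c p * norm p"
  have frontier_norm: "norm (x\<^sub>0 - c) = \<rho>" if x0: "x\<^sub>0 \<in> frontier K" for x\<^sub>0
  proof -
    let ?R = "norm (x\<^sub>0 - c)"
    let ?S = "frontier K \<inter> sphere c ?R"
    have "compact ?S" by (intro compact_Int compact_frontier K compact_sphere)
    moreover have "x\<^sub>0 \<in> ?S" using x0 by (simp add: dist_norm norm_minus_commute)
    moreover have "continuous_on ?S (\<lambda>y. y \<bullet> p)" by (intro continuous_intros)
    ultimately obtain x where x: "x \<in> ?S" and min: "\<And>y. y \<in> ?S \<Longrightarrow> x \<bullet> p \<le> y \<bullet> p"
      using continuous_attains_inf[of ?S "\<lambda>y. y \<bullet> p"] by blast
    define X where "X = x - c"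
    define q where "q = x - P"
    have Xq: "X = q + p" by (simp add: X_def q_def p_def)
    have "P \<in> interior K" using ball P(1) by auto
    then have q0: "q \<noteq> 0" using x F by (auto simp: q_def)
    \<comment> \<open>\<open>W\<close> is the image of \<open>X\<close> under the half turn about \<open>q\<close>; it is lower than \<open>X\<close> unless it equals \<open>X\<close>.\<close>
    define \<mu> where "\<mu> = (X \<bullet> q) / (q \<bullet> q)"
    have \<mu>: "\<mu> * (q \<bullet> q) = X \<bullet> q" using q0 by (simp add: \<mu>_def)
    define W where "W = (2 * \<mu>) *\<^sub>R q - X"
    have WW: "W \<bullet> W = X \<bullet> X"
      using \<mu> by (simp add: W_def inner_diff_left inner_diff_right inner_commute algebra_simps)
    have Wq: "(W - X) \<bullet> q = 0"
      using \<mu> by (simp add: W_def inner_diff_left inner_commute algebra_simps)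
    have nW: "norm W = norm X" using WW by (simp add: norm_eq)
    have nX: "norm X = ?R" using x by (simp add: X_def dist_norm norm_minus_commute)
    have "c + W \<in> frontier K"
    proof (rule turn[of x])
      show "norm (c + W - c) = norm (x - c)" using nW by (simp add: X_def)
      show "(c + W - x) \<bullet> (x - P) = 0" using Wq by (simp add: X_def q_def algebra_simps)
    qed (use x in simp)
    then have "c + W \<in> ?S" using nW nX by (simp add: dist_norm)
    \<comment> \<open>\<open>W - X\<close> is orthogonal to \<open>q\<close> and
      \<open>X = q + p\<close>, so minimality bounds its product with \<open>X\<close> from below;
      equal norms turn this into a nonpositive square.\<close>
    from min[OF this] have "0 \<le> (W - X) \<bullet> p" by (simp add: X_def inner_diff_left inner_add_left)
    moreover have "(W - X) \<bullet> X = (W - X) \<bullet> q + (W - X) \<bullet> p"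
      using Xq inner_add_right by metis
    ultimately have "0 \<le> (W - X) \<bullet> X" using Wq by simp
    moreover have "(W - X) \<bullet> (W - X) = - 2 * ((W - X) \<bullet> X)"
      using WW by (simp add: inner_diff_left inner_diff_right inner_commute algebra_simps)
    ultimately have "(W - X) \<bullet> (W - X) \<le> 0" by simp
    then have "W = X" using inner_eq_zero_iff[of "W - X"] inner_ge_zero[of "W - X"] by simp
    \<comment> \<open>Being fixed by the half turn, \<open>X\<close> is a multiple of
      \<open>q = X - p\<close>, hence of \<open>p\<close>; the factor 1 would force
      \<open>p = 0\<close>.\<close>
    then have "2 *\<^sub>R X = 2 *\<^sub>R (\<mu> *\<^sub>R q)" by (simp add: W_def scaleR_2 algebra_simps)
    then have "X = \<mu> *\<^sub>R q" by (subst (asm) scaleR_cancel_left) simp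
    moreover have "p = X - q" using Xq by simp
    ultimately have lin: "(\<mu> - 1) *\<^sub>R X = \<mu> *\<^sub>R p"
      by (simp only: scaleR_diff_left scaleR_diff_right scaleR_one)
    then have "\<mu> \<noteq> 1" using p by auto
    define t where "t = \<mu> / (\<mu> - 1)"
    have "X = (1 / (\<mu> - 1)) *\<^sub>R ((\<mu> - 1) *\<^sub>R X)" using \<open>\<mu> \<noteq> 1\<close> by simp
    then have Xt: "X = t *\<^sub>R p" unfolding lin by (simp add: t_def)
    have xF: "x \<in> frontier K" using x by simp
    \<comment> \<open>\<open>t\<close> may be negative; central symmetry moves the point onto the
      ray through \<open>P\<close> that defines \<open>\<rho>\<close>.\<close>
    have "c + t *\<^sub>R p \<in> frontier K" "c + (- t) *\<^sub>R p \<in> frontier K"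
      using xF neg[OF xF] Xt by (simp_all add: X_def algebra_simps scaleR_2)
    then have "c + \<bar>t\<bar> *\<^sub>R p \<in> frontier K" by (cases "0 \<le> t") simp_all
    then have "reach K c p = \<bar>t\<bar>" using F Rp(2)[of "\<bar>t\<bar>"] Rp(3)[of "\<bar>t\<bar>"] by auto
    then show ?thesis using Xt nX by (simp add: \<rho>_def)
  qed
  have mem: "x \<in> K \<longleftrightarrow> norm (x - c) \<le> \<rho>" if "x \<noteq> c" for x
  proof -
    have v: "x - c \<noteq> 0" using that by simp
    note R = reach[OF K cI v]
    let ?d = "reach K c (x - c)"
    have "c + ?d *\<^sub>R (x - c) \<in> frontier K" using F R(1) R(2,3)[of ?d] by simp
    then have "?d * norm (x - c) = \<rho>" using frontier_norm R(1) by fastforce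
    moreover have "x \<in> K \<longleftrightarrow> 1 \<le> ?d" using R(2)[of 1] by simp
    ultimately show ?thesis using v
      by (metis mult_le_cancel_right1 norm_not_less_zero norm_le_zero_iff not_le)
  qed
  have "\<rho> > 0" using Rp(1) p by (simp add: \<rho>_def)
  moreover have "K = cball c \<rho>"
  proof (rule set_eqI)
    fix x
    show "x \<in> K \<longleftrightarrow> x \<in> cball c \<rho>"
      using mem[of x] cI interior_subset[of K] \<open>\<rho> > 0\<close>
      by (cases "x = c") (auto simp: dist_norm norm_minus_commute)
  qed
  ultimately show ?thesis by blast
qed

section \<open>Planes through \<open>P\<close> and the conclusion\<close>

lemma orthonormal_frame_of_normal:
  fixes n :: "'a::euclidean_space"
  assumes "n \<noteq> 0" "DIM('a) = 3"
  obtains u v where "norm u = 1" "norm v = 1" "u \<bullet> v = 0" "n \<bullet> u = 0" "n \<bullet> v = 0"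
    "\<And>z. n \<bullet> z = 0 \<Longrightarrow> \<exists>x y. z = x *\<^sub>R u + y *\<^sub>R v"
proof -
  obtain B where B: "B \<subseteq> {z. n \<bullet> z = 0}" "pairwise orthogonal B" "\<And>x. x \<in> B \<Longrightarrow> norm x = 1"
    "independent B" "card B = dim {z. n \<bullet> z = 0}" "span B = {z. n \<bullet> z = 0}"
    by (rule orthonormal_basis_subspace[OF subspace_hyperplane[of n]]) (rule that)
  have "card B = 2" using B(5) dim_hyperplane[OF assms(1)] assms(2) by simp
  then obtain u v where uv: "B = {u, v}" "u \<noteq> v" by (auto simp: card_2_iff)
  show ?thesis
  proof (rule that[of u v])
    show "norm u = 1" "norm v = 1" "n \<bullet> u = 0" "n \<bullet> v = 0" using B(1,3) uv by auto
    show "u \<bullet> v = 0" using B(2) uv by (simp add: pairwise_def orthogonal_def)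
    show "\<exists>x y. z = x *\<^sub>R u + y *\<^sub>R v" if "n \<bullet> z = 0" for z
    proof -
      have "z \<in> span {u, v}" using that B(6) uv by auto
      then obtain x y where "z - x *\<^sub>R u = y *\<^sub>R v" by (auto simp: span_insert span_singleton)
      then have "z = x *\<^sub>R u + y *\<^sub>R v" by (simp add: algebra_simps)
      then show ?thesis by blast
    qed
  qed
qed

theorem theorem6:
  fixes K :: "(real ^ 3) set" and c P :: "real ^ 3" and r :: real
  assumes "convex_body K"
    and "r > 0"
    and "cball c r \<subseteq> interior K"
    and "P \<in> interior (cball c r)"
    and "P \<noteq> c"
    and "\<And>H. is_plane H \<Longrightarrow> P \<in> H \<Longrightarrow>
           equipotential_circle H (H \<inter> K) (H \<inter> frontier (cball c r))"
  shows "\<exists>z \<rho>. \<rho> > 0 \<and> K = cball z \<rho>"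
proof -
  have K: "compact K" "convex K" using assms(1) by (auto simp: convex_body_def)
  have P: "dist c P < r" using assms(4) by (simp add: interior_cball)
  have "2 *\<^sub>R m - x \<in> K"
    if x: "x \<in> K" and m: "(x - m) \<bullet> (m - c) = 0" "(P - m) \<bullet> (m - c) = 0" for x m
  proof -
    \<comment> \<open>A normal of the plane of section: \<open>m - c\<close> if nonzero, otherwise
      any vector orthogonal to \<open>x - m\<close> and \<open>P - m\<close>, which cannot span the
      space. The last property makes \<open>m\<close> the projection of \<open>c\<close>.\<close>
    obtain n where n: "n \<noteq> 0" "n \<bullet> (x - m) = 0" "n \<bullet> (P - m) = 0"
      "\<And>z. n \<bullet> z = 0 \<Longrightarrow> (m - c) \<bullet> z = 0"
    proof (cases "m = c")
      case True
      have "dim {x - m, P - m} \<le> card {x - m, P - m}" by (rule dim_le_card') simp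
      also have "\<dots> < DIM(real ^ 3)" by (simp add: card_insert_if)
      finally obtain n where "n \<noteq> 0" "\<And>y. y \<in> span {x - m, P - m} \<Longrightarrow> orthogonal n y"
        using orthogonal_to_subspace_exists by blast
      then show ?thesis using that[of n] True by (simp add: orthogonal_def span_base)
    next
      case False
      then show ?thesis using that[of "m - c"] m by (simp add: inner_commute)
    qed
    obtain u v where uv: "norm u = 1" "norm v = 1" "u \<bullet> v = 0" "n \<bullet> u = 0" "n \<bullet> v = 0"
      "\<And>z. n \<bullet> z = 0 \<Longrightarrow> \<exists>x y. z = x *\<^sub>R u + y *\<^sub>R v"
      by (rule orthonormal_frame_of_normal[OF n(1)]) (simp, rule that)
    define H where "H = {z. n \<bullet> z = n \<bullet> m}"
    have plane: "is_plane H" and PH: "P \<in> H"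
      using n by (simp_all add: is_plane_def H_def affine_hyperplane inner_diff_right)
    \<comment> \<open>The right angle at \<open>m\<close> gives \<open>m\<close> distance less than
      \<open>r\<close> from \<open>c\<close>, so the section circle has positive radius
      \<open>s\<close>.\<close>
    have "(norm ((P - m) + (m - c)))\<^sup>2 = (norm (P - m))\<^sup>2 + (norm (m - c))\<^sup>2"
      using m(2) by (intro norm_add_Pythagorean) (simp add: orthogonal_def)
    then have "(norm (m - c))\<^sup>2 \<le> (norm (P - c))\<^sup>2" by simp
    also have "\<dots> < r\<^sup>2"
      using P by (intro power_strict_mono) (simp_all add: dist_norm norm_minus_commute)
    finally have s2: "0 < r\<^sup>2 - (norm (m - c))\<^sup>2" by simp
    define s where "s = sqrt (r\<^sup>2 - (norm (m - c))\<^sup>2)"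
    have s: "s > 0" "r\<^sup>2 = s\<^sup>2 + (norm (m - c))\<^sup>2" using s2 by (simp_all add: s_def)
    obtain k where k: "\<And>t. m + s *\<^sub>R direction u v t \<in> interior K"
      "\<And>t. reach K (m + s *\<^sub>R direction u v t) (- direction u v (t + pi / 2)) *
           reach K (m + s *\<^sub>R direction u v t) (direction u v (t + pi / 2)) = k"
    proof (rule equipotential_circle_constant_power[OF K uv(1-3) _ _ _ _ s(1) assms(2) s(2) assms(3)])
      show "affine H" by (simp add: H_def affine_hyperplane)
      show "m + (x *\<^sub>R u + y *\<^sub>R v) \<in> H" for x y
        using uv(4,5) by (simp add: H_def inner_add_right)
      show "(m - c) \<bullet> u = 0" "(m - c) \<bullet> v = 0" using n(4) uv(4,5) by auto
      show "equipotential_circle H (H \<inter> K) (H \<inter> sphere c r)"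
        using assms(6)[OF plane PH] by (simp add: frontier_cball)
    qed (rule that)
    obtain a b where ab: "x - m = a *\<^sub>R u + b *\<^sub>R v" using uv(6) n(2) by blast
    have "m + (a *\<^sub>R u + b *\<^sub>R v) \<in> K" using x by (simp flip: ab)
    from constant_power_imp_symmetric[OF K uv(1-3) s(1) k this]
    have "m - (x - m) \<in> K" by (simp add: ab)
    then show ?thesis by (simp add: scaleR_2 algebra_simps)
  qed
  from sectional_symmetry_imp_ball[OF K assms(3) P assms(5) this] show ?thesis by blast
qed

end
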